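(* For any unimodal range map $\delta$, the partial composition maps $\circ_i$ on $\mathbf{Cl}_\delta$ satisfy, for any $u,v\in\mathsf{Cl}_\delta$ and $1\le i\le|u|$, $$\mathsf{F}_u\circ_i\mathsf{F}_v=\chi_\delta(u\,\square_i\,v)\sum_{w\in[u\,\square_i\,v,\;u\,\blacksquare_i\,v]_{\preccurlyeq}}\mathsf{F}_w .$$
   Context: $\mathbb{N}=\{0,1,2,\dots\}$ and $\mathbb{K}$ is a field of characteristic zero. A range map is a map $\delta:\mathbb{N}\setminus\{0\}\to\mathbb{N}$. It is unimodal if there are no $1\le i_1<i_2<i_3$ with $\delta(i_1)>\delta(i_2)<\delta(i_3)$. For a word $w$ on $\mathbb{N}$, $\ell(w)$ is its length, $w(i)$ its $i$-th letter, $\epsilon$ is the empty word. A $\delta$-cliff is a word $w$ on $\mathbb{N}$ with $0\le w(i)\le\delta(i)$ for all $i$; its size is $|w|:=\ell(w)+1$; $\mathsf{Cl}_\delta$ is the graded set of all $\delta$-cliffs. $\chi_\delta(w):=1$ if $w\in\mathsf{Cl}_\delta$ and $\chi_\delta(w):=0$ otherwise. For words $u,v$ and $1\le i\le|u|$, $u\,\square_i\,v:=u(1)\cdots u(i-1)\;v\;u(i)\cdots u(\ell(u))$. For $\delta$ unimodal, $\mathbf{Cl}_\delta$ is the nonsymmetric operad over $\mathbb{K}$ with basis $\{\mathsf{E}_w:w\in\mathsf{Cl}_\delta\}$ ($\mathsf{E}_w$ of arity $|w|$), partial compositions $\mathsf{E}_u\circ_i\mathsf{E}_v=\chi_\delta(u\,\square_i\,v)\,\mathsf{E}_{u\,\square_i\,v}$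 (that is, $0$ when $u\,\square_i\,v$ is not a $\delta$-cliff), and unit $\mathsf{E}_\epsilon$. Order: for $u,v$ of the same length, $u\preccurlyeq v$ iff $u(j)\le v(j)$ for all $j$; $[u,v]_\preccurlyeq$ is the interval of the poset of $\delta$-cliffs of that length (when $u\,\square_i\,v$ is a $\delta$-cliff, so is $u\,\blacksquare_i\,v$ defined below; when it is not, the right-hand side is read as $0$). Fundamental basis: $\mathsf{F}_w:=\sum_{w'\in\mathsf{Cl}_\delta,\,w\preccurlyeq w'}\mu_\preccurlyeq(w,w')\,\mathsf{E}_{w'}$, where $\mu_\preccurlyeq$ is the Möbius function of the poset $\preccurlyeq$ on $\delta$-cliffs of a given size; equivalently $\mathsf{E}_w=\sum_{w'\in\mathsf{Cl}_\delta,\,w\preccurlyeq w'}\mathsf{F}_{w'}$. Operation $\blacksquare_i$: for $w\in\mathsf{Cl}_\delta$ and $f:\{1,\dots,\ell(w)\}\to\mathbb{N}\setminus\{0\}$, let $\mathrm{m}^f_\delta(w)$ be the word of length $\ell(w)$ with $j$-th letter $\delta(f(j))$ if $w(j)=\delta(j)$, and $w(j)$ otherwise. For $u,v\in\mathsf{Cl}_\delta$ and $1\le i\le|u|$, $u\,\blacksquare_i\,v:=\mathrm{m}^f_\delta(u)\,\square_i\,\mathrm{m}^g_\delta(v)$, where $f(j):=j$ if $j\le i-1$, $f(j):=j+\ell(v)$ otherwise, and $g(j):=j+i-1$. *)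

theory Defs
  imports Complex_Main "HOL-Library.Poly_Mapping"
begin

text \<open>
  Words on the natural numbers are lists. Positions of letters are numbered from 1, so the
  \<^term>\<open>i\<close>-th letter of \<^term>\<open>w\<close> is \<^term>\<open>w ! (i - 1)\<close>. A range map is a function
  \<^term>\<open>\<delta>\<close> of which only the values at positive arguments matter; \<^term>\<open>\<delta> 0\<close> is never used.
\<close>

definition unimodal :: "(nat \<Rightarrow> nat) \<Rightarrow> bool" where
  "unimodal \<delta> \<longleftrightarrow>
     \<not> (\<exists>i\<^sub>1 i\<^sub>2 i\<^sub>3. 1 \<le> i\<^sub>1 \<and> i\<^sub>1 < i\<^sub>2 \<and> i\<^sub>2 < i\<^sub>3 \<and> \<delta> i\<^sub>1 > \<delta> i\<^sub>2 \<and> \<delta> i\<^sub>2 < \<delta> i\<^sub>3)"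

definition cliffs :: "(nat \<Rightarrow> nat) \<Rightarrow> nat list set" where
  "cliffs \<delta> = {w. \<forall>i\<in>{1..length w}. w ! (i - 1) \<le> \<delta> i}"

text \<open>The size of a cliff, which is the arity of the corresponding operad element.\<close>

definition arity :: "nat list \<Rightarrow> nat" where
  "arity w = length w + 1"

definition chi :: "(nat \<Rightarrow> nat) \<Rightarrow> nat list \<Rightarrow> 'k::field_char_0" where
  "chi \<delta> w = (if w \<in> cliffs \<delta> then 1 else 0)"

definition insert_word :: "nat list \<Rightarrow> nat \<Rightarrow> nat list \<Rightarrow> nat list" where
  "insert_word u i v = take (i - 1) u @ v @ drop (i - 1) u"

definition word_le :: "nat list \<Rightarrow> nat list \<Rightarrow> bool" (infix "\<preceq>" 50) where
  "u \<preceq> v \<longleftrightarrow> list_all2 (\<le>) u v"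

definition cliff_interval :: "(nat \<Rightarrow> nat) \<Rightarrow> nat list \<Rightarrow> nat list \<Rightarrow> nat list set" where
  "cliff_interval \<delta> u v = {w \<in> cliffs \<delta>. u \<preceq> w \<and> w \<preceq> v}"

lemma sum_list_less_if_word_le:
  assumes "u \<preceq> v" "u \<noteq> v"
  shows "sum_list u < sum_list v"
proof -
  have "list_all2 (\<le>) u v" using assms(1) by (simp add: word_le_def)
  hence "sum_list u \<le> sum_list v \<and> (u \<noteq> v \<longrightarrow> sum_list u < sum_list v)"
    by (induction rule: list_all2_induct) auto
  thus ?thesis using assms(2) by blast
qed

text \<open>
  The Moebius function of the poset of cliffs: it is 1 on the diagonal, and its sum over the
  second argument in any nontrivial interval vanishes.
\<close>

function mobius :: "(nat \<Rightarrow> nat) \<Rightarrow> nat list \<Rightarrow> nat list \<Rightarrow> int" where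
  "mobius \<delta> u v =
     (if u = v then 1
      else if u \<preceq> v then - (\<Sum>w\<in>cliff_interval \<delta> u v - {v}. mobius \<delta> u w)
      else 0)"
  by pat_completeness auto
termination
  by (relation "Wellfounded.measure (\<lambda>(\<delta>, u, v). sum_list v)")
    (auto simp: cliff_interval_def intro: sum_list_less_if_word_le)

declare mobius.simps [simp del]

text \<open>
  Finitely supported functions on words form the free vector space on all words; the space
  underlying the operad of \<^term>\<open>\<delta>\<close>-cliffs is its subspace of functions supported on
  \<^term>\<open>cliffs \<delta>\<close>, graded by \<^const>\<open>arity\<close>.
\<close>

definition cliff_component :: "(nat \<Rightarrow> nat) \<Rightarrow> nat \<Rightarrow> (nat list \<Rightarrow>\<^sub>0 'k::field_char_0) set" where
  "cliff_component \<delta> n = {x. Poly_Mapping.keys x \<subseteq> {w \<in> cliffs \<delta>. arity w = n}}"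

definition scale :: "'k::field_char_0 \<Rightarrow> (nat list \<Rightarrow>\<^sub>0 'k) \<Rightarrow> (nat list \<Rightarrow>\<^sub>0 'k)" where
  "scale c x = Poly_Mapping.map ((*) c) x"

definition elementary :: "nat list \<Rightarrow> (nat list \<Rightarrow>\<^sub>0 'k::field_char_0)" where
  "elementary w = Poly_Mapping.single w 1"

text \<open>
  The \<^term>\<open>i\<close>-th partial composition is the bilinear extension of its values on the elementary
  basis. It is meaningful on \<^term>\<open>cliff_component \<delta> n \<times> cliff_component \<delta> m\<close> for
  \<^term>\<open>1 \<le> i \<and> i \<le> n\<close>, where it takes values in \<^term>\<open>cliff_component \<delta> (n + m - 1)\<close>.
\<close>

definition partial_comp ::
    "(nat \<Rightarrow> nat) \<Rightarrow> nat \<Rightarrow> (nat list \<Rightarrow>\<^sub>0 'k::field_char_0) \<Rightarrow> (nat list \<Rightarrow>\<^sub>0 'k) \<Rightarrow> (nat list \<Rightarrow>\<^sub>0 'k)"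
  where
  "partial_comp \<delta> i x y =
     (\<Sum>u\<in>Poly_Mapping.keys x. \<Sum>v\<in>Poly_Mapping.keys y.
        scale (Poly_Mapping.lookup x u * Poly_Mapping.lookup y v)
          (scale (chi \<delta> (insert_word u i v)) (elementary (insert_word u i v))))"

definition fundamental :: "(nat \<Rightarrow> nat) \<Rightarrow> nat list \<Rightarrow> (nat list \<Rightarrow>\<^sub>0 'k::field_char_0)" where
  "fundamental \<delta> w =
     (\<Sum>w'\<in>{w' \<in> cliffs \<delta>. w \<preceq> w'}. scale (of_int (mobius \<delta> w w')) (elementary w'))"

definition raise_maximal :: "(nat \<Rightarrow> nat) \<Rightarrow> (nat \<Rightarrow> nat) \<Rightarrow> nat list \<Rightarrow> nat list" where
  "raise_maximal \<delta> f w =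
     map (\<lambda>j. if w ! (j - 1) = \<delta> j then \<delta> (f j) else w ! (j - 1)) [1..<length w + 1]"

definition black_insert :: "(nat \<Rightarrow> nat) \<Rightarrow> nat list \<Rightarrow> nat \<Rightarrow> nat list \<Rightarrow> nat list" where
  "black_insert \<delta> u i v =
     insert_word
       (raise_maximal \<delta> (\<lambda>j. if j \<le> i - 1 then j else j + length v) u)
       i
       (raise_maximal \<delta> (\<lambda>j. j + i - 1) v)"

text \<open>The sum defining \<^const>\<open>fundamental\<close> is finite.\<close>

lemma finite_cliffs_above: "finite {w' \<in> cliffs \<delta>. w \<preceq> w'}"
proof -
  define N where "N = Max (\<delta> ` {1..length w})"
  have "{w' \<in> cliffs \<delta>. w \<preceq> w'} \<subseteq> {w'. set w' \<subseteq> {..N} \<and> length w' = length w}"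
  proof clarify
    fix w' assume c: "w' \<in> cliffs \<delta>" and le: "w \<preceq> w'"
    have len: "length w' = length w"
      using le by (auto simp: word_le_def dest: list_all2_lengthD)
    have "x \<le> N" if x: "x \<in> set w'" for x
    proof -
      from x obtain k where k: "k < length w'" "x = w' ! k" by (auto simp: in_set_conv_nth)
      hence "x \<le> \<delta> (Suc k)" using c unfolding cliffs_def
        by (auto dest!: bspec[where x = "Suc k"])
      also have "\<dots> \<le> N" unfolding N_def using k len by (intro Max_ge) auto
      finally show ?thesis .
    qed
    thus "set w' \<subseteq> {..N} \<and> length w' = length w" using len by auto
  qed
  thus ?thesis by (rule finite_subset) (simp add: finite_lists_length_eq)
qed

lemma lookup_scale: "Poly_Mapping.lookup (scale c x) w = c * Poly_Mapping.lookup x w"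
  by (simp add: scale_def Poly_Mapping.map.rep_eq when_def)

lemma vector_space_scale: "vector_space (scale :: 'k::field_char_0 \<Rightarrow> _)"
  by unfold_locales
    (auto intro!: poly_mapping_eqI simp: lookup_scale lookup_add algebra_simps)

lemma partial_comp_elementary:
  "partial_comp \<delta> i (elementary u) (elementary v) =
     scale (chi \<delta> (insert_word u i v) :: 'k::field_char_0) (elementary (insert_word u i v))"
  by (rule poly_mapping_eqI) (simp add: partial_comp_def elementary_def lookup_scale)

lemma cliff_component_sum:
  assumes "\<And>a. a \<in> A \<Longrightarrow> f a \<in> cliff_component \<delta> n"
  shows "sum f A \<in> cliff_component \<delta> n"
  using assms Poly_Mapping.keys_sum[of f A] unfolding cliff_component_def by blast

lemma scale_elementary_in_component:
  assumes "c \<noteq> 0 \<Longrightarrow> w \<in> cliffs \<delta> \<and> arity w = n"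
  shows "scale c (elementary w) \<in> cliff_component \<delta> n"
  using assms
  by (auto simp: cliff_component_def in_keys_iff lookup_scale elementary_def lookup_single when_def
      split: if_splits)

lemma fundamental_in_component: "fundamental \<delta> w \<in> cliff_component \<delta> (arity w)"
  unfolding fundamental_def
  by (intro cliff_component_sum scale_elementary_in_component)
    (auto simp: arity_def word_le_def dest: list_all2_lengthD)

lemma partial_comp_in_component:
  assumes "x \<in> cliff_component \<delta> n" "y \<in> cliff_component \<delta> m"
  shows "partial_comp \<delta> i x y \<in> cliff_component \<delta> (n + m - 1)"
proof -
  have *: "scale c (scale d x) = scale (c * d) x" for c d :: 'a and x
    by (rule poly_mapping_eqI) (simp add: lookup_scale)
  have len: "arity (insert_word u i v) = n + m - 1"
    if "u \<in> Poly_Mapping.keys x" "v \<in> Poly_Mapping.keys y" for u v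
  proof -
    have "arity u = n" "arity v = m" using that assms by (auto simp: cliff_component_def)
    thus ?thesis by (auto simp: arity_def insert_word_def)
  qed
  show ?thesis
    unfolding partial_comp_def *
    by (intro cliff_component_sum scale_elementary_in_component)
      (auto simp: chi_def len split: if_splits)
qed

end

theory Submission
  imports Defs
begin

text \<open>
  The poset of \<open>\<delta>\<close>-cliffs of a given length is a product of chains, so the coefficient of
  \<open>E\<^sub>z\<close> in \<open>F\<^sub>u\<close> is a product of local factors: 1 if \<open>z(j) = u(j)\<close>, -1 if
  \<open>z(j) = u(j) + 1 \<le> \<delta>(j)\<close>, and 0 otherwise. Hence both sides of the claim factor over the
  positions of \<open>u \<box>\<^sub>i v\<close>. At a position carrying a letter \<open>x\<close>, with bound \<open>e\<close> in the source
  word and bound \<open>d\<close> in the composed word, the local sum over \<open>[x, b]\<close> telescopes, where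
  \<open>b = d\<close> if \<open>x = e\<close> and \<open>b = x\<close> otherwise; the result is the factor for the bound \<open>e\<close>.
\<close>

section \<open>Cliffs as the words below a word of bounds\<close>

definition bounds :: "(nat \<Rightarrow> nat) \<Rightarrow> nat \<Rightarrow> nat list" where
  "bounds \<delta> n = map \<delta> [1..<n + 1]"

lemma length_bounds [simp]: "length (bounds \<delta> n) = n"
  by (simp add: bounds_def)

lemma nth_bounds [simp]: "k < n \<Longrightarrow> bounds \<delta> n ! k = \<delta> (Suc k)"
  by (simp add: bounds_def del: upt_Suc)

text \<open>With the bounds stored as a word, being a cliff is a single instance of the letterwise
  order. Bound words can then be cut and inserted exactly like the words they bound.\<close>

lemma mem_cliffs_iff: "w \<in> cliffs \<delta> \<longleftrightarrow> w \<preceq> bounds \<delta> (length w)"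
proof
  assume "w \<in> cliffs \<delta>"
  hence "w ! k \<le> \<delta> (Suc k)" if "k < length w" for k
    using that by (auto simp: cliffs_def dest!: bspec[where x = "Suc k"])
  thus "w \<preceq> bounds \<delta> (length w)"
    by (simp add: word_le_def list_all2_conv_all_nth)
next
  assume le: "w \<preceq> bounds \<delta> (length w)"
  have "w ! (i - 1) \<le> \<delta> i" if "i \<in> {1..length w}" for i
    using that list_all2_nthD[OF le[unfolded word_le_def], of "i - 1"] by auto
  thus "w \<in> cliffs \<delta>" by (simp add: cliffs_def)
qed

lemma word_le_length: "u \<preceq> v \<Longrightarrow> length u = length v"
  by (auto simp: word_le_def dest: list_all2_lengthD)

lemma word_le_trans: "u \<preceq> v \<Longrightarrow> v \<preceq> w \<Longrightarrow> u \<preceq> w"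
  unfolding word_le_def by (rule list_all2_trans[where ?P1.0 = "(\<le>)"]) auto

lemma word_le_antisym: "u \<preceq> v \<Longrightarrow> v \<preceq> u \<Longrightarrow> u = v"
  unfolding word_le_def by (rule list_all2_antisym[where P = "(\<le>)" and Q = "(\<le>)"]) auto

lemma word_le_simps [simp]:
  "[] \<preceq> v \<longleftrightarrow> v = []" "u \<preceq> [] \<longleftrightarrow> u = []" "x # u \<preceq> y # v \<longleftrightarrow> x \<le> y \<and> u \<preceq> v"
  by (auto simp: word_le_def)

section \<open>Boxes of words and the Moebius function of the cliff poset\<close>

definition word_box :: "nat list \<Rightarrow> nat list \<Rightarrow> nat list set" where
  "word_box u v = {w. u \<preceq> w \<and> w \<preceq> v}"

lemma word_box_Nil [simp]: "word_box [] [] = {[]}"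
  by (auto simp: word_box_def)

lemma sum_word_box_Cons:
  "(\<Sum>w\<in>word_box (x # u) (y # v). f w) = (\<Sum>a = x..y. \<Sum>w\<in>word_box u v. f (a # w))"
proof -
  have "word_box (x # u) (y # v) = (\<lambda>(a, w). a # w) ` ({x..y} \<times> word_box u v)"
    by (auto simp: word_box_def word_le_def list_all2_Cons1)
  thus ?thesis
    by (simp add: sum.reindex inj_on_def sum.cartesian_product case_prod_unfold)
qed

text \<open>Cliffs are closed downwards, so below a cliff the condition on \<open>w\<close> is
  automatic. The interval then becomes a product of integer intervals, over which sums
  factor.\<close>

lemma cliff_interval_eq_word_box:
  assumes "v \<in> cliffs \<delta>"
  shows "cliff_interval \<delta> u v = word_box u v"
proof -
  have "w \<in> cliffs \<delta>" if "w \<preceq> v" for w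
    using word_le_trans[OF that] word_le_length[OF that] assms by (simp add: mem_cliffs_iff)
  thus ?thesis by (auto simp: cliff_interval_def word_box_def)
qed

text \<open>The first argument is the maximum of the chain, respectively the list of the maxima.\<close>

definition chain_mobius :: "nat \<Rightarrow> nat \<Rightarrow> nat \<Rightarrow> int" where
  "chain_mobius d x y = (if y = x then 1 else if y = Suc x \<and> y \<le> d then - 1 else 0)"

fun box_mobius :: "nat list \<Rightarrow> nat list \<Rightarrow> nat list \<Rightarrow> int" where
  "box_mobius [] [] [] = 1"
| "box_mobius (d # ds) (x # xs) (y # ys) = chain_mobius d x y * box_mobius ds xs ys"
| "box_mobius _ _ _ = 0"

lemma box_mobius_append:
  assumes "length ds = length xs" "length ys = length xs"
  shows "box_mobius (ds @ ds') (xs @ xs') (ys @ ys') = box_mobius ds xs ys * box_mobius ds' xs' ys'"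
  using assms
  by (induction ds xs ys rule: box_mobius.induct) auto

lemma box_mobius_nonzeroD:
  assumes "box_mobius ds xs ys \<noteq> 0"
  shows "xs \<preceq> ys"
  using assms
  by (induction ds xs ys rule: box_mobius.induct) (auto simp: chain_mobius_def split: if_splits)

text \<open>The bound is built into the off-diagonal value -1 only: on the diagonal
  \<open>chain_mobius\<close> is 1 whatever the bound, and there the premise
  \<open>xs \<preceq> ds\<close> takes over.\<close>

lemma box_mobius_nonzero_boundD:
  assumes "box_mobius ds xs ys \<noteq> 0" "xs \<preceq> ds"
  shows "ys \<preceq> ds"
  using assms
  by (induction ds xs ys rule: box_mobius.induct) (auto simp: chain_mobius_def split: if_splits)

lemma sum_chain_mobius_right:
  assumes "x \<le> z" "z \<le> d"
  shows "(\<Sum>y = x..z. chain_mobius d x y) = (if x = z then 1 else 0)"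
proof (cases "x = z")
  case False
  \<comment> \<open>Only two terms survive, 1 at \<open>x\<close> and -1 at \<open>Suc x\<close>;
    the latter is within the bound because \<open>Suc x\<close> \<le> \<open>z\<close> \<le>
    \<open>d\<close>.\<close>
  hence "(\<Sum>y = x..z. chain_mobius d x y) = (\<Sum>y\<in>{x, Suc x}. chain_mobius d x y)"
    using assms by (intro sum.mono_neutral_right) (auto simp: chain_mobius_def)
  thus ?thesis using False assms by (simp add: chain_mobius_def)
qed (simp add: chain_mobius_def)

lemma sum_box_mobius_right:
  assumes "u \<preceq> v" "v \<preceq> ds"
  shows "(\<Sum>w\<in>word_box u v. box_mobius ds u w) = (if u = v then 1 else 0)"
  using assms
proof (induction u arbitrary: v ds)
  case (Cons x u)
  then obtain y v' d ds' where eq: "v = y # v'" "ds = d # ds'"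
    by (metis word_le_simps(2) neq_Nil_conv)
  show ?case
    using Cons.prems Cons.IH[of v' ds'] unfolding eq
    by (simp add: sum_word_box_Cons sum_chain_mobius_right flip: sum_product)
qed simp

text \<open>By \<open>sum_box_mobius_right\<close>, the product formula obeys the recursion that
  defines the Moebius function. The sum of the letters serves as induction measure, since it drops
  strictly below \<open>v\<close>.\<close>

lemma mobius_eq_box_mobius:
  assumes "v \<in> cliffs \<delta>"
  shows "mobius \<delta> u v = box_mobius (bounds \<delta> (length v)) u v"
  using assms
proof (induction v rule: measure_induct_rule[of sum_list])
  case (less v)
  let ?B = "bounds \<delta> (length v)"
  have le: "v \<preceq> ?B" using less.prems by (simp add: mem_cliffs_iff)
  have refl: "v \<preceq> v" by (simp add: word_le_def list_all2_refl)
  show ?case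
  proof (cases "u \<preceq> v")
    case False
    moreover have "u \<noteq> v" using False refl by auto
    ultimately show ?thesis
      using box_mobius_nonzeroD[of ?B u v] by (auto simp: mobius.simps[of \<delta> u v])
  next
    case True
    have fin: "finite (word_box u v)"
      by (rule finite_subset[OF _ finite_cliffs_above[of \<delta> u]])
        (use cliff_interval_eq_word_box[OF less.prems, of u] in \<open>auto simp: cliff_interval_def\<close>)
    have mem: "v \<in> word_box u v" using True refl by (simp add: word_box_def)
    have total: "box_mobius ?B u v + (\<Sum>w\<in>word_box u v - {v}. box_mobius ?B u w)
        = (if u = v then 1 else 0)"
      using sum_box_mobius_right[OF True le] sum.remove[OF fin mem, of "box_mobius ?B u"] by simp
    show ?thesis
    proof (cases "u = v")
      case True
      \<comment> \<open>The remaining sum in \<open>total\<close> is now empty, so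
        \<open>total\<close> gives the value 1 on the diagonal.\<close>
      have "word_box v v = {v}"
        using refl by (auto simp: word_box_def dest: word_le_antisym)
      thus ?thesis using total True by (simp add: mobius.simps[of \<delta> v v])
    next
      case False
      have "mobius \<delta> u w = box_mobius ?B u w" if "w \<in> word_box u v - {v}" for w
      proof -
        have w: "w \<preceq> v" "w \<noteq> v" using that by (auto simp: word_box_def)
        \<comment> \<open>Equal lengths ensure that the induction hypothesis for \<open>w\<close>
          speaks of the same bound word \<open>?B\<close>.\<close>
        have len: "length w = length v" using word_le_length[OF w(1)] .
        hence "w \<in> cliffs \<delta>"
          using word_le_trans[OF w(1) le] by (simp add: mem_cliffs_iff)
        thus ?thesis
          using less.IH[OF sum_list_less_if_word_le[OF w]] len by simp
      qed
      hence "mobius \<delta> u v = - (\<Sum>w\<in>word_box u v - {v}. box_mobius ?B u w)"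
        using True False
        by (simp add: mobius.simps[of \<delta> u v] cliff_interval_eq_word_box[OF less.prems])
      thus ?thesis using total False by simp
    qed
  qed
qed

text \<open>The formula covers every word \<open>z\<close>: the product of local factors vanishes
  unless \<open>z\<close> is a cliff above \<open>u\<close>, so no case distinction survives into
  later computations.\<close>

lemma lookup_fundamental:
  assumes "u \<in> cliffs \<delta>"
  shows "Poly_Mapping.lookup (fundamental \<delta> u :: nat list \<Rightarrow>\<^sub>0 'k::field_char_0) z
    = of_int (box_mobius (bounds \<delta> (length u)) u z)"
proof -
  let ?A = "{w' \<in> cliffs \<delta>. u \<preceq> w'}" and ?b = "box_mobius (bounds \<delta> (length u)) u z"
  have "Poly_Mapping.lookup (fundamental \<delta> u :: nat list \<Rightarrow>\<^sub>0 'k) z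
      = (\<Sum>w'\<in>?A. if w' = z then of_int (mobius \<delta> u z) else 0)"
    by (auto simp: fundamental_def lookup_sum lookup_scale elementary_def lookup_single when_def
        intro!: sum.cong)
  also have "\<dots> = (if z \<in> ?A then of_int (mobius \<delta> u z) else 0)"
    by (simp add: sum.delta[OF finite_cliffs_above])
  also have "\<dots> = of_int ?b"
  proof (cases "z \<in> ?A")
    case True
    thus ?thesis using word_le_length[of u z] by (simp add: mobius_eq_box_mobius)
  next
    case False
    have "?b = 0"
    proof (rule ccontr)
      assume nz: "?b \<noteq> 0"
      have "u \<preceq> z" using box_mobius_nonzeroD[OF nz] .
      moreover have "z \<preceq> bounds \<delta> (length u)"
        using box_mobius_nonzero_boundD[OF nz] assms by (simp add: mem_cliffs_iff)
      ultimately show False using False word_le_length[of u z] by (simp add: mem_cliffs_iff)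
    qed
    thus ?thesis using False by auto
  qed
  finally show ?thesis .
qed

section \<open>Raised words and summation over the lower argument\<close>

fun raise_word :: "nat list \<Rightarrow> nat list \<Rightarrow> nat list \<Rightarrow> nat list" where
  "raise_word (e # es) (d # ds) (x # xs) = (if x = e then d else x) # raise_word es ds xs"
| "raise_word _ _ _ = []"

lemma length_raise_word [simp]:
  "length (raise_word es ds xs) = min (length es) (min (length ds) (length xs))"
  by (induction es ds xs rule: raise_word.induct) auto

lemma nth_raise_word:
  assumes "k < length es" "k < length ds" "k < length xs"
  shows "raise_word es ds xs ! k = (if xs ! k = es ! k then ds ! k else xs ! k)"
  using assms
  by (induction es ds xs arbitrary: k rule: raise_word.induct) (auto simp: nth_Cons split: nat.splits)

lemma raise_word_le:
  assumes "xs \<preceq> ds" "length es = length xs"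
  shows "raise_word es ds xs \<preceq> ds"
  using assms by (induction es ds xs rule: raise_word.induct) auto

text \<open>If \<open>x = e\<close>, the terms at \<open>z - 1\<close> and \<open>z\<close> cancel
  when \<open>z\<close> > \<open>x\<close>, which leaves the indicator of \<open>z = e\<close>. If
  \<open>x\<close> < \<open>e\<close>, the only term is \<open>y = x\<close>, and the bounds
  \<open>d\<close> and \<open>e\<close> give the same factor because \<open>z\<close> \<le>
  \<open>d\<close> and \<open>Suc x\<close> \<le> \<open>e\<close>. No comparison between
  \<open>d\<close> and \<open>e\<close> is made.\<close>

lemma sum_chain_mobius_left:
  assumes "x \<le> e" "x \<le> d" "z \<le> d"
  shows "(\<Sum>y = x..(if x = e then d else x). chain_mobius d y z) = chain_mobius e x z"
proof (cases "x = e")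
  case True
  consider "z < x" | "z = x" | "x < z" by linarith
  thus ?thesis
  proof cases
    case 3
    then obtain m where m: "z = Suc m" by (cases z) auto
    have "(\<Sum>y = x..d. chain_mobius d y z) = (\<Sum>y\<in>{m, z}. chain_mobius d y z)"
      using assms 3 m by (intro sum.mono_neutral_right) (auto simp: chain_mobius_def)
    thus ?thesis using True 3 m assms by (simp add: chain_mobius_def)
  next
    case 2
    have "(\<Sum>y = x..d. chain_mobius d y z) = (\<Sum>y\<in>{x}. chain_mobius d y z)"
      using assms 2 by (intro sum.mono_neutral_right) (auto simp: chain_mobius_def)
    thus ?thesis using True 2 by (simp add: chain_mobius_def)
  next
    case 1
    hence "(\<Sum>y = x..d. chain_mobius d y z) = 0"
      by (intro sum.neutral) (auto simp: chain_mobius_def)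
    thus ?thesis using True 1 by (simp add: chain_mobius_def)
  qed
qed (use assms in \<open>auto simp: chain_mobius_def\<close>)

text \<open>Letterwise product of the chain identity: summing up to the raised word trades the
  bounds \<open>ds\<close> for \<open>es\<close>.\<close>

lemma sum_box_mobius_left:
  assumes "xs \<preceq> es" "xs \<preceq> ds" "zs \<preceq> ds"
  shows "(\<Sum>w\<in>word_box xs (raise_word es ds xs). box_mobius ds w zs) = box_mobius es xs zs"
  using assms
proof (induction xs arbitrary: es ds zs)
  case (Cons x xs)
  obtain e es' where es: "es = e # es'" using Cons.prems(1) by (cases es) auto
  obtain d ds' where ds: "ds = d # ds'" using Cons.prems(2) by (cases ds) auto
  obtain z zs' where zs: "zs = z # zs'" using Cons.prems(3) ds by (cases zs) auto
  show ?case
    using Cons.prems Cons.IH[of es' ds' zs'] sum_chain_mobius_left[of x e d z]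
    unfolding es ds zs raise_word.simps sum_word_box_Cons box_mobius.simps
    by (simp only: sum_product[symmetric] word_le_simps)
qed simp

section \<open>Insertion of words and its compatibility with the product formula\<close>

lemma length_insert_word [simp]: "length (insert_word u i v) = length u + length v"
  by (auto simp: insert_word_def)

lemma nth_insert_word:
  assumes "k < length u + length v" "i - 1 \<le> length u"
  shows "insert_word u i v ! k =
    (if k < i - 1 then u ! k else if k < i - 1 + length v then v ! (k - (i - 1))
     else u ! (k - length v))"
  using assms by (auto simp: insert_word_def nth_append min_def)

lemma insert_word_le_insert_word:
  assumes "u \<preceq> u'" "v \<preceq> v'"
  shows "insert_word u i v \<preceq> insert_word u' i v'"
  using assms unfolding insert_word_def word_le_def
  by (intro list_all2_appendI list_all2_takeI list_all2_dropI)

lemma insert_word_inject: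
  assumes "length u = length u'" "length v = length v'"
  shows "insert_word u i v = insert_word u' i v' \<longleftrightarrow> u = u' \<and> v = v'"
proof
  assume "insert_word u i v = insert_word u' i v'"
  hence "take (i - 1) u = take (i - 1) u'" "v = v'" "drop (i - 1) u = drop (i - 1) u'"
    using assms by (auto simp: insert_word_def)
  thus "u = u' \<and> v = v'" by (metis append_take_drop_id)
qed simp

lemma insert_word_surj:
  assumes "length z = n + m" "i - 1 \<le> n"
  obtains p q where "z = insert_word p i q" "length p = n" "length q = m"
proof
  \<comment> \<open>The inserted word is the block of \<open>m\<close> letters after the first
    \<open>i - 1\<close>; the outer word is what remains once that block is cut out.\<close>
  let ?p = "take (i - 1) z @ drop (i - 1 + m) z" and ?q = "take m (drop (i - 1) z)"
  have "drop m (drop (i - 1) z) = drop (i - 1 + m) z" by (simp add: add.commute)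
  hence "?q @ drop (i - 1 + m) z = drop (i - 1) z" by (metis append_take_drop_id)
  moreover have "take (i - 1) ?p = take (i - 1) z" "drop (i - 1) ?p = drop (i - 1 + m) z"
    using assms by (auto simp: min_def)
  ultimately show "z = insert_word ?p i ?q"
    unfolding insert_word_def by (metis append_take_drop_id)
qed (use assms in auto)

lemma box_mobius_insert_word:
  assumes "length u = length d" "length p = length d" "length v = length e" "length q = length e"
  shows "box_mobius (insert_word d i e) (insert_word u i v) (insert_word p i q)
    = box_mobius d u p * box_mobius e v q"
proof -
  have "box_mobius d u p = box_mobius (take (i - 1) d @ drop (i - 1) d)
      (take (i - 1) u @ drop (i - 1) u) (take (i - 1) p @ drop (i - 1) p)"
    by simp
  also have "\<dots> = box_mobius (take (i - 1) d) (take (i - 1) u) (take (i - 1) p)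
      * box_mobius (drop (i - 1) d) (drop (i - 1) u) (drop (i - 1) p)"
    using assms by (intro box_mobius_append) auto
  finally show ?thesis
    using assms by (simp add: insert_word_def box_mobius_append)
qed

text \<open>The index maps in \<open>black_insert\<close> record where each letter lands, so a
  maximal letter is raised to the bound at its new position. The inserted bound words supply the old
  bounds, against which maximality is tested.\<close>

lemma black_insert_eq_raise_word:
  assumes "1 \<le> i" "i \<le> arity u"
  shows "black_insert \<delta> u i v = raise_word
    (insert_word (bounds \<delta> (length u)) i (bounds \<delta> (length v)))
    (bounds \<delta> (length u + length v)) (insert_word u i v)"
proof (rule nth_equalityI)
  show "length (black_insert \<delta> u i v) = length (raise_word
    (insert_word (bounds \<delta> (length u)) i (bounds \<delta> (length v)))
    (bounds \<delta> (length u + length v)) (insert_word u i v))"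
    by (simp add: black_insert_def raise_maximal_def del: upt_Suc)
next
  fix k assume "k < length (black_insert \<delta> u i v)"
  hence k: "k < length u + length v"
    by (simp add: black_insert_def raise_maximal_def del: upt_Suc)
  have i: "i - 1 \<le> length u" using assms by (simp add: arity_def)
  show "black_insert \<delta> u i v ! k = raise_word
    (insert_word (bounds \<delta> (length u)) i (bounds \<delta> (length v)))
    (bounds \<delta> (length u + length v)) (insert_word u i v) ! k"
    using k i assms(1)
    by (auto simp: nth_raise_word nth_insert_word black_insert_def raise_maximal_def Suc_diff_le
        simp del: upt_Suc)
qed

section \<open>Coefficients of a composition and comparison of both sides\<close>

lemma lookup_partial_comp:
  assumes "x \<in> cliff_component \<delta>' (Suc n)" "y \<in> cliff_component \<delta>' (Suc m)"
    and "length p = n" "length q = m"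
  shows "Poly_Mapping.lookup (partial_comp \<delta> i x y) (insert_word p i q)
    = chi \<delta> (insert_word p i q) * Poly_Mapping.lookup x p * Poly_Mapping.lookup y q"
proof -
  \<comment> \<open>Homogeneity fixes the lengths of all words in the supports, so at most the pair
    \<open>p\<close>, \<open>q\<close> contributes to this coefficient.\<close>
  have eq: "insert_word u i v = insert_word p i q \<longleftrightarrow> u = p \<and> v = q"
    if "u \<in> Poly_Mapping.keys x" "v \<in> Poly_Mapping.keys y" for u v
    using that assms by (intro insert_word_inject) (auto simp: cliff_component_def arity_def)
  let ?c = "chi \<delta> (insert_word p i q) * Poly_Mapping.lookup x p * Poly_Mapping.lookup y q"
  have "Poly_Mapping.lookup (partial_comp \<delta> i x y) (insert_word p i q)
    = (\<Sum>u\<in>Poly_Mapping.keys x. \<Sum>v\<in>Poly_Mapping.keys y.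
        if v = q then if u = p then ?c else 0 else 0)"
    unfolding partial_comp_def lookup_sum
    by (intro sum.cong refl) (auto simp: lookup_scale elementary_def lookup_single when_def eq)
  also have "\<dots> = ?c"
    \<comment> \<open>A word outside the support has coefficient 0, so \<open>?c\<close> is 0 as
      well when the double sum misses the pair.\<close>
    by (cases "q \<in> Poly_Mapping.keys y"; cases "p \<in> Poly_Mapping.keys x")
      (simp_all add: in_keys_iff)
  finally show ?thesis .
qed

theorem proposition2p2p3:
  fixes \<delta> :: "nat \<Rightarrow> nat" and u v :: "nat list" and i :: nat
  assumes "unimodal \<delta>"
    and "u \<in> cliffs \<delta>" and "v \<in> cliffs \<delta>"
    and "1 \<le> i" and "i \<le> arity u"
  shows "partial_comp \<delta> i (fundamental \<delta> u) (fundamental \<delta> v :: nat list \<Rightarrow>\<^sub>0 'k::field_char_0) =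
    scale (chi \<delta> (insert_word u i v))
      (\<Sum>w\<in>cliff_interval \<delta> (insert_word u i v) (black_insert \<delta> u i v). fundamental \<delta> w)"
    (is "?L = ?R")
proof (rule poly_mapping_eqI)
  fix z
  let ?a = "insert_word u i v" and ?n = "length u" and ?m = "length v"
  let ?e = "insert_word (bounds \<delta> ?n) i (bounds \<delta> ?m)" and ?d = "bounds \<delta> (?n + ?m)"
  have comp: "fundamental \<delta> u \<in> cliff_component \<delta> (Suc ?n)"
      "fundamental \<delta> v \<in> cliff_component \<delta> (Suc ?m)"
    using fundamental_in_component[of \<delta>] by (auto simp: arity_def)
  have R_support: "z \<in> cliffs \<delta> \<and> length z = ?n + ?m" if "Poly_Mapping.lookup ?R z \<noteq> 0"
  proof -
    have "(\<Sum>w\<in>cliff_interval \<delta> ?a (black_insert \<delta> u i v). fundamental \<delta> w :: nat list \<Rightarrow>\<^sub>0 'k)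
        \<in> cliff_component \<delta> (arity ?a)"
    proof (rule cliff_component_sum)
      fix w assume "w \<in> cliff_interval \<delta> ?a (black_insert \<delta> u i v)"
      hence "arity w = arity ?a" by (auto simp: cliff_interval_def arity_def dest!: word_le_length)
      thus "(fundamental \<delta> w :: nat list \<Rightarrow>\<^sub>0 'k) \<in> cliff_component \<delta> (arity ?a)"
        using fundamental_in_component[of \<delta> w] by simp
    qed
    thus ?thesis
      using that by (auto simp: lookup_scale cliff_component_def arity_def in_keys_iff)
  qed
  have L_support: "length z = ?n + ?m" if "Poly_Mapping.lookup ?L z \<noteq> 0"
    using that partial_comp_in_component[OF comp, of i]
    by (auto simp: cliff_component_def arity_def in_keys_iff)
  show "Poly_Mapping.lookup ?L z = Poly_Mapping.lookup ?R z"
  proof (cases "length z = ?n + ?m")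
    case False
    thus ?thesis using L_support R_support by metis
  next
    case True
    moreover have "i - 1 \<le> ?n" using assms(5) by (simp add: arity_def)
    ultimately obtain p q where z: "z = insert_word p i q" "length p = ?n" "length q = ?m"
      by (rule insert_word_surj)
    \<comment> \<open>The two coefficients merge into one product in which each letter keeps the
      bound of its source word; these bounds form \<open>?e\<close>.\<close>
    have L: "Poly_Mapping.lookup ?L z = chi \<delta> z * of_int (box_mobius ?e ?a z)"
      unfolding z(1) lookup_partial_comp[OF comp z(2,3)]
      by (simp add: lookup_fundamental assms box_mobius_insert_word z)
    show ?thesis
    proof (cases "z \<in> cliffs \<delta>")
      case False
      hence "Poly_Mapping.lookup ?R z = 0" using R_support by blast
      thus ?thesis using False unfolding L by (simp add: chi_def)
    next
      case zc: True
      hence zd: "z \<preceq> ?d" using True by (simp add: mem_cliffs_iff)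
      show ?thesis
      proof (cases "?a \<in> cliffs \<delta>")
        case False
        \<comment> \<open>A nonzero value would put \<open>?a\<close> below the cliff
          \<open>z\<close>, and downward closure would make \<open>?a\<close> a cliff.\<close>
        hence "box_mobius ?e ?a z = 0"
          using box_mobius_nonzeroD[of ?e ?a z] zd word_le_trans[of ?a z ?d]
          by (auto simp: mem_cliffs_iff)
        thus ?thesis using False by (simp add: L chi_def lookup_scale)
      next
        case a: True
        let ?b = "raise_word ?e ?d ?a"
        have ad: "?a \<preceq> ?d" using a by (simp add: mem_cliffs_iff)
        have ae: "?a \<preceq> ?e"
          using assms(2,3) by (intro insert_word_le_insert_word) (simp_all add: mem_cliffs_iff)
        have "?b \<preceq> ?d" using raise_word_le[OF ad] by simp
        hence b: "?b \<in> cliffs \<delta>" by (simp add: mem_cliffs_iff)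
        have "Poly_Mapping.lookup ?R z = (\<Sum>w\<in>word_box ?a ?b.
            Poly_Mapping.lookup (fundamental \<delta> w :: nat list \<Rightarrow>\<^sub>0 'k) z)"
          using a b assms(4,5)
          by (simp add: black_insert_eq_raise_word cliff_interval_eq_word_box chi_def
              lookup_scale lookup_sum)
        also have "\<dots> = (\<Sum>w\<in>word_box ?a ?b. of_int (box_mobius ?d w z))"
        proof (rule sum.cong[OF refl])
          fix w assume "w \<in> word_box ?a ?b"
          hence "w \<in> cliffs \<delta>" "length w = ?n + ?m"
            using cliff_interval_eq_word_box[OF b, of ?a]
            by (auto simp: cliff_interval_def dest!: word_le_length)
          thus "Poly_Mapping.lookup (fundamental \<delta> w :: nat list \<Rightarrow>\<^sub>0 'k) z
            = of_int (box_mobius ?d w z)"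
            by (simp add: lookup_fundamental)
        qed
        \<comment> \<open>The fundamental elements on the right carry the bounds \<open>?d\<close>
          of the composed word; the sum over the interval turns these into \<open>?e\<close>, as on
          the left.\<close>
        also have "\<dots> = of_int (box_mobius ?e ?a z)"
          using sum_box_mobius_left[OF ae ad zd] by (simp flip: of_int_sum)
        finally show ?thesis using zc by (simp add: L chi_def)
      qed
    qed
  qed
qed

end
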